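(* Let $q$ be a prime power, let $n$ be a positive integer with $\gcd(n,q)=1$, let $\lambda\in\mathbb{F}_q^*$, and let $\mathcal{C}\subseteq\mathbb{F}_q^n$ be a $\lambda$-constacyclic code with nontrivial pattern polynomial $p(x)=\sum_{j=0}^{n/v-1}\alpha^jx^{jv}\ne 1$ (so $v\mid n$, $v<n$, $\alpha\in\mathbb{F}_q^*$). Let $\overline{\mathcal{C}}$ be the core of $\mathcal{C}$. Then for every integer $i\ge 1$ the generator polynomial of $\mathcal{C}^{\circ i}$ is given by $$\overline{g}_i(x)\,(p(x))^{\circ i},$$ where $\overline{g}_i(x)$ is the generator polynomial of $(\overline{\mathcal{C}})^{\circ i}$ and $(p(x))^{\circ i}=\sum_{j=0}^{n/v-1}\alpha^{ij}x^{jv}$ is the $i$-th Schur power of $p(x)$.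
   Context: Vectors $(a_0,\ldots,a_{n-1})\in\mathbb{F}_q^n$ are identified with polynomials $\sum_{i=0}^{n-1}a_ix^i$. For $\lambda\in\mathbb{F}_q^*$, a $\lambda$-constacyclic code of length $n$ is (under this identification) an ideal of $\mathbb{F}_q[x]/\langle x^n-\lambda\rangle$; every such code is generated by a unique monic polynomial $g(x)$ dividing $x^n-\lambda$, one writes $\mathcal{C}=\langle g(x)\rangle$, and $g(x)$ is the generator polynomial of $\mathcal{C}$. The pattern polynomial of $\mathcal{C}=\langle g(x)\rangle$ is the polynomial $p(x)=\sum_{j=0}^{n/v-1}\alpha^jx^{jv}$ with $v$ a divisor of $n$, $\alpha\in\mathbb{F}_q^*$, $p(x)\mid g(x)$, and $v$ minimal with these properties ($v=n$ gives the trivial pattern polynomial $p=1$). A constacyclic code is called degenerate if its pattern polynomial is nontrivial, and non-degenerate otherwise. If the pattern polynomial of $\mathcal{C}$ is nontrivial, the core $\overline{\mathcal{C}}$ of $\mathcal{C}$ is the non-degenerate constacyclic code of length $v$ obtained as the image of $\mathcal{C}$ under the one-to-one map $c(x)\mapsto c(x)/p(x)$, where codewords $c(x)$ are polynomials of degree less than $n$. The Schur product $\circ$ of vectors (equivalently, of the corresponding polynomials) is the component-wise product; for codes, $\mathcal{C}_1\circ\mathcal{C}_2=\operatorname{span}_{\mathbb{F}_q}\{\mathbf{c}_1\circ\mathbf{c}_2:\mathbf{c}_1\in\mathcal{C}_1,\mathbf{c}_2\in\mathcal{C}_2\}$, and $\mathcal{C}^{\circ i}=\mathcal{C}\circ\cdots\circ\mathcal{C}$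 ($i$ times). The Schur product of a $\lambda_1$-constacyclic code and a $\lambda_2$-constacyclic code is $\lambda_1\lambda_2$-constacyclic.
   Formalization: Generator polynomials are monic, but the product of the generator of the core's i-th Schur power with the i-th Schur power of p(x) need not be (q=3, n=2, C=<x-1>, p=1-x), so the formal statement divides this product by its leading coefficient. *)

theory Defs
  imports "HOL-Computational_Algebra.Polynomial" "HOL-Algebra.Ideal"
begin

text \<open>
  A vector \<open>(a\<^sub>0, \<dots>, a\<^sub>n\<^sub>-\<^sub>1)\<close> is represented by the polynomial of degree
  less than \<open>n\<close> with these coefficients.  The quotient ring by \<open>x^n - \<Lambda>\<close> is represented
  on the same polynomials, which are the canonical representatives of its residue classes.
\<close>

definition constacyclic_modulus :: "nat \<Rightarrow> 'a::field \<Rightarrow> 'a poly" where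
  "constacyclic_modulus n \<Lambda> = monom 1 n - [:\<Lambda>:]"

definition constacyclic_ring :: "nat \<Rightarrow> 'a::field \<Rightarrow> 'a poly ring" where
  "constacyclic_ring n \<Lambda> =
     \<lparr> carrier = {f. degree f < n},
       monoid.mult = (\<lambda>f g. (f * g) mod constacyclic_modulus n \<Lambda>),
       one = 1,
       zero = 0,
       add = (+) \<rparr>"

definition constacyclic_code :: "nat \<Rightarrow> 'a::field \<Rightarrow> 'a poly set \<Rightarrow> bool" where
  "constacyclic_code n \<Lambda> C \<longleftrightarrow> n > 0 \<and> \<Lambda> \<noteq> 0 \<and> ideal C (constacyclic_ring n \<Lambda>)"

text \<open>The reduction of \<open>g\<close> only matters for the zero code, where \<open>g = x^n - \<Lambda>\<close>.\<close>

definition is_generator_poly :: "nat \<Rightarrow> 'a::field \<Rightarrow> 'a poly set \<Rightarrow> 'a poly \<Rightarrow> bool" where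
  "is_generator_poly n \<Lambda> C g \<longleftrightarrow>
     lead_coeff g = 1 \<and> g dvd constacyclic_modulus n \<Lambda> \<and>
     C = PIdl\<^bsub>constacyclic_ring n \<Lambda>\<^esub> (g mod constacyclic_modulus n \<Lambda>)"

definition generator_poly :: "nat \<Rightarrow> 'a::field \<Rightarrow> 'a poly set \<Rightarrow> 'a poly" where
  "generator_poly n \<Lambda> C = (THE g. is_generator_poly n \<Lambda> C g)"

definition pattern_poly :: "nat \<Rightarrow> nat \<Rightarrow> 'a::field \<Rightarrow> 'a poly" where
  "pattern_poly n v \<alpha> = (\<Sum>j<n div v. monom (\<alpha> ^ j) (j * v))"

text \<open>
  \<open>v\<close> is determined by the code, but \<open>\<alpha>\<close> need not be: for the zero code several \<open>\<alpha>\<close>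
  can qualify, and so does every \<open>\<alpha>\<close> if \<open>v = n\<close>.
\<close>

definition is_pattern :: "nat \<Rightarrow> 'a::field \<Rightarrow> 'a poly set \<Rightarrow> nat \<Rightarrow> 'a \<Rightarrow> bool" where
  "is_pattern n \<Lambda> C v \<alpha> \<longleftrightarrow>
     v dvd n \<and> \<alpha> \<noteq> 0 \<and> pattern_poly n v \<alpha> dvd generator_poly n \<Lambda> C \<and>
     (\<forall>w \<beta>. w dvd n \<longrightarrow> \<beta> \<noteq> 0 \<longrightarrow> pattern_poly n w \<beta> dvd generator_poly n \<Lambda> C \<longrightarrow> v \<le> w)"

text \<open>
  If the pattern polynomial \<open>p\<close> given by \<open>v\<close> and \<open>\<alpha>\<close> is nontrivial, then up to a constant
  \<open>x^n - \<Lambda>\<close> is \<open>p * (x^v - \<alpha>^(-1))\<close>, so the core is \<open>\<alpha>^(-1)\<close>-constacyclic of length \<open>v\<close>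
  (lemma \<open>constacyclic_code_core\<close> below).
\<close>

definition core :: "'a::field poly \<Rightarrow> 'a poly set \<Rightarrow> 'a poly set" where
  "core p C = (\<lambda>c. c div p) ` C"

lift_definition schur :: "'a::mult_zero poly \<Rightarrow> 'a poly \<Rightarrow> 'a poly" (infixl \<open>\<odot>\<close> 70)
  is "\<lambda>f g k. f k * g k"
  by (erule eventually_mono) simp

definition schur_code :: "'a::field poly set \<Rightarrow> 'a poly set \<Rightarrow> 'a poly set" where
  "schur_code C D = module.span smult {c \<odot> d | c d. c \<in> C \<and> d \<in> D}"

text \<open>Only the powers with exponent \<open>i \<ge> 1\<close> are meaningful.\<close>

definition schur_power :: "'a::field poly \<Rightarrow> nat \<Rightarrow> 'a poly" where
  "schur_power f i = ((\<lambda>h. h \<odot> f) ^^ (i - 1)) f"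

definition schur_code_power :: "'a::field poly set \<Rightarrow> nat \<Rightarrow> 'a poly set" where
  "schur_code_power C i = ((\<lambda>D. schur_code D C) ^^ (i - 1)) C"

text \<open>
  Generator polynomials are monic, but a product of a generator polynomial with a Schur power
  of a pattern polynomial need not be; it has to be normalised by its leading coefficient.
\<close>

definition monic_of :: "'a::field poly \<Rightarrow> 'a poly" where
  "monic_of f = smult (inverse (lead_coeff f)) f"


subsection \<open>Constacyclic codes have unique generator polynomials\<close>

lemma degree_constacyclic_modulus: "n > 0 \<Longrightarrow> degree (constacyclic_modulus n \<Lambda>) = n"
proof -
  assume "n > 0"
  then have "degree (monom (1::'a) n + [:- \<Lambda>:]) = degree (monom (1::'a) n)"
    by (intro degree_add_eq_left) (simp add: degree_monom_eq)
  then show ?thesis by (simp add: constacyclic_modulus_def degree_monom_eq diff_conv_add_uminus del: add_uminus_conv_diff)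
qed

lemma constacyclic_modulus_neq_0: "n > 0 \<Longrightarrow> constacyclic_modulus n \<Lambda> \<noteq> 0"
  using degree_constacyclic_modulus[of n \<Lambda>] by auto

lemma degree_mod_constacyclic_modulus: "n > 0 \<Longrightarrow> degree (f mod constacyclic_modulus n \<Lambda>) < n"
  by (metis constacyclic_modulus_neq_0 degree_0 degree_constacyclic_modulus degree_mod_less')

lemma mod_constacyclic_modulus_id: "degree f < n \<Longrightarrow> f mod constacyclic_modulus n \<Lambda> = f"
  by (simp add: mod_poly_less degree_constacyclic_modulus)

lemma constacyclic_ring_simps [simp]:
  "carrier (constacyclic_ring n \<Lambda>) = {f. degree f < n}"
  "f \<otimes>\<^bsub>constacyclic_ring n \<Lambda>\<^esub> g = (f * g) mod constacyclic_modulus n \<Lambda>"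
  "\<one>\<^bsub>constacyclic_ring n \<Lambda>\<^esub> = 1"
  "\<zero>\<^bsub>constacyclic_ring n \<Lambda>\<^esub> = 0"
  "f \<oplus>\<^bsub>constacyclic_ring n \<Lambda>\<^esub> g = f + g"
  by (simp_all add: constacyclic_ring_def)

lemma cring_constacyclic_ring:
  assumes "n > 0"
  shows "cring (constacyclic_ring n \<Lambda>)"
proof (rule cringI)
  show "abelian_group (constacyclic_ring n \<Lambda>)"
  proof (rule abelian_groupI)
    fix f assume "f \<in> carrier (constacyclic_ring n \<Lambda>)"
    then show "\<exists>g\<in>carrier (constacyclic_ring n \<Lambda>).
        g \<oplus>\<^bsub>constacyclic_ring n \<Lambda>\<^esub> f = \<zero>\<^bsub>constacyclic_ring n \<Lambda>\<^esub>"
      by (intro bexI[of _ "- f"]) auto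
  qed (use assms in \<open>simp_all add: degree_add_less ac_simps\<close>)
  show "Group.comm_monoid (constacyclic_ring n \<Lambda>)"
    by (rule comm_monoidI)
      (use assms in \<open>auto simp: degree_mod_constacyclic_modulus mod_constacyclic_modulus_id
        mod_mult_left_eq mod_mult_right_eq mult_ac\<close>)
qed (simp add: distrib_right poly_mod_add_left)

lemma constacyclic_code_iff:
  "constacyclic_code n \<Lambda> C \<longleftrightarrow>
     n > 0 \<and> \<Lambda> \<noteq> 0 \<and> C \<subseteq> {c. degree c < n} \<and> 0 \<in> C \<and> (\<forall>c\<in>C. \<forall>d\<in>C. c + d \<in> C) \<and>
     (\<forall>c\<in>C. \<forall>r. (r * c) mod constacyclic_modulus n \<Lambda> \<in> C)"
proof (intro iffI conjI)
  assume C: "constacyclic_code n \<Lambda> C"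
  then interpret ideal C "constacyclic_ring n \<Lambda>" by (simp add: constacyclic_code_def)
  show n: "n > 0" and "\<Lambda> \<noteq> 0" using C by (auto simp: constacyclic_code_def)
  show "C \<subseteq> {c. degree c < n}" using a_subset by simp
  show "0 \<in> C" using additive_subgroup.zero_closed[OF is_additive_subgroup] by simp
  show "\<forall>c\<in>C. \<forall>d\<in>C. c + d \<in> C" using additive_subgroup.a_closed[OF is_additive_subgroup] by simp
  show "\<forall>c\<in>C. \<forall>r. (r * c) mod constacyclic_modulus n \<Lambda> \<in> C"
  proof safe
    fix c r assume c: "c \<in> C"
    have "((r mod constacyclic_modulus n \<Lambda>) * c) mod constacyclic_modulus n \<Lambda> \<in> C"
      using I_l_closed[OF c, of "r mod constacyclic_modulus n \<Lambda>"] n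
      by (simp add: degree_mod_constacyclic_modulus)
    then show "(r * c) mod constacyclic_modulus n \<Lambda> \<in> C"
      by (simp add: mod_mult_left_eq)
  qed
next
  assume *: "n > 0 \<and> \<Lambda> \<noteq> 0 \<and> C \<subseteq> {c. degree c < n} \<and> 0 \<in> C \<and> (\<forall>c\<in>C. \<forall>d\<in>C. c + d \<in> C) \<and>
     (\<forall>c\<in>C. \<forall>r. (r * c) mod constacyclic_modulus n \<Lambda> \<in> C)"
  interpret cring "constacyclic_ring n \<Lambda>" using * by (simp add: cring_constacyclic_ring)
  have neg: "- c \<in> C" if c: "c \<in> C" for c
  proof -
    have "(- 1 * c) mod constacyclic_modulus n \<Lambda> \<in> C" using * c by blast
    moreover have "degree (- 1 * c) < n" using * c by auto
    ultimately show ?thesis by (simp add: mod_constacyclic_modulus_id)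
  qed
  have "ideal C (constacyclic_ring n \<Lambda>)"
  proof (rule idealI)
    show "ring (constacyclic_ring n \<Lambda>)" ..
    have inv: "inv\<^bsub>add_monoid (constacyclic_ring n \<Lambda>)\<^esub> c = - c" if "c \<in> C" for c
    proof -
      have "\<ominus>\<^bsub>constacyclic_ring n \<Lambda>\<^esub> c = - c"
        using that * by (intro minus_equality) auto
      then show ?thesis by (simp add: a_inv_def)
    qed
    show "subgroup C (add_monoid (constacyclic_ring n \<Lambda>))"
      by (rule subgroup.intro) (use * inv neg in \<open>auto\<close>)
  qed (use * in \<open>auto simp: mult.commute\<close>)
  then show "constacyclic_code n \<Lambda> C" using * by (simp add: constacyclic_code_def)
qed

lemma mem_PIdl_constacyclic_ring:
  assumes "n > 0"
  shows "c \<in> PIdl\<^bsub>constacyclic_ring n \<Lambda>\<^esub> (g mod constacyclic_modulus n \<Lambda>) \<longleftrightarrow>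
    (\<exists>r. c = (r * g) mod constacyclic_modulus n \<Lambda>)"
proof
  assume "c \<in> PIdl\<^bsub>constacyclic_ring n \<Lambda>\<^esub> (g mod constacyclic_modulus n \<Lambda>)"
  then show "\<exists>r. c = (r * g) mod constacyclic_modulus n \<Lambda>"
    by (auto simp: cgenideal_def mod_mult_right_eq)
next
  assume "\<exists>r. c = (r * g) mod constacyclic_modulus n \<Lambda>"
  then obtain r where "c = (r * g) mod constacyclic_modulus n \<Lambda>" ..
  then have "c = ((r mod constacyclic_modulus n \<Lambda>) * (g mod constacyclic_modulus n \<Lambda>))
      mod constacyclic_modulus n \<Lambda>"
    by (simp add: mod_mult_eq)
  then show "c \<in> PIdl\<^bsub>constacyclic_ring n \<Lambda>\<^esub> (g mod constacyclic_modulus n \<Lambda>)"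
    using assms degree_mod_constacyclic_modulus by (auto simp: cgenideal_def)
qed

lemma is_generator_poly_dvd:
  assumes "n > 0" "is_generator_poly n \<Lambda> C g" "c \<in> C"
  shows "g dvd c"
proof -
  obtain r where "c = (r * g) mod constacyclic_modulus n \<Lambda>"
    using assms mem_PIdl_constacyclic_ring[of n c \<Lambda> g] by (auto simp: is_generator_poly_def)
  moreover have "g dvd constacyclic_modulus n \<Lambda>" using assms by (simp add: is_generator_poly_def)
  ultimately show ?thesis by (simp add: dvd_mod)
qed

lemma is_generator_poly_unique:
  assumes "n > 0" "is_generator_poly n \<Lambda> C g" "is_generator_poly n \<Lambda> C h"
  shows "g = h"
proof -
  have "g dvd h" if "is_generator_poly n \<Lambda> C g" "is_generator_poly n \<Lambda> C h" for g h
  proof -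
    have "h mod constacyclic_modulus n \<Lambda> \<in> C"
      using that mem_PIdl_constacyclic_ring[OF assms(1), of "h mod constacyclic_modulus n \<Lambda>" \<Lambda> h]
      by (simp add: is_generator_poly_def) (metis mult_1)
    then have "g dvd h mod constacyclic_modulus n \<Lambda>"
      using is_generator_poly_dvd[OF assms(1)] that by blast
    moreover have "g dvd constacyclic_modulus n \<Lambda>" using that by (simp add: is_generator_poly_def)
    ultimately show ?thesis by (simp add: dvd_mod_iff)
  qed
  then have "g dvd h" "h dvd g" using assms by auto
  moreover have lc: "lead_coeff g = 1" "lead_coeff h = 1"
    using assms by (auto simp: is_generator_poly_def)
  ultimately obtain k where k: "h = g * k" "degree k = 0"
    by (metis add_cancel_right_right antisym degree_mult_eq dvdE dvd_imp_degree_le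
        leading_coeff_0_iff mult_zero_right zero_neq_one)
  then obtain a where a: "k = [:a:]" by (blast elim: degree_eq_zeroE)
  have "lead_coeff h = lead_coeff g * lead_coeff k" unfolding k(1) by (rule lead_coeff_mult)
  then have "a = 1" using lc a by simp
  then show "g = h" using k a by simp
qed

lemma ex_is_generator_poly:
  assumes C: "constacyclic_code n \<Lambda> C"
  shows "\<exists>g. is_generator_poly n \<Lambda> C g"
proof -
  define m where "m = constacyclic_modulus n \<Lambda>"
  note C' = C[unfolded constacyclic_code_iff, folded m_def]
  have m0: "m \<noteq> 0" using C' by (simp add: m_def constacyclic_modulus_neq_0)
  define J where "J = {f. f mod m \<in> C}"
  have mJ: "m \<in> J" using C' by (simp add: J_def)
  have lJ: "r * f \<in> J" if "f \<in> J" for r f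
  proof -
    have "(r * (f mod m)) mod m \<in> C" using that C' by (auto simp: J_def)
    then show ?thesis by (simp add: J_def mod_mult_right_eq)
  qed
  have aJ: "f + h \<in> J" if "f \<in> J" "h \<in> J" for f h
    using that C' by (auto simp: J_def poly_mod_add_left)
  obtain g0 where g0: "g0 \<in> J" "g0 \<noteq> 0"
    and min0: "\<And>f. f \<in> J \<Longrightarrow> f \<noteq> 0 \<Longrightarrow> degree g0 \<le> degree f"
    using ex_has_least_nat[of "\<lambda>f. f \<in> J \<and> f \<noteq> 0" m degree] mJ m0 by blast
  define g where "g = monic_of g0"
  have monic: "lead_coeff g = 1" using g0 by (simp add: g_def monic_of_def)
  have gJ: "g \<in> J" using lJ[OF g0(1), of "[:inverse (lead_coeff g0):]"]
    by (simp add: g_def monic_of_def)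
  have g_dvd: "g dvd f" if f: "f \<in> J" for f
  proof -
    have "f mod g \<in> J"
      using aJ[OF f lJ[OF gJ, of "- (f div g)"]]
      by (simp add: minus_div_mult_eq_mod[symmetric])
    moreover have "degree g = degree g0" using g0 by (simp add: g_def monic_of_def)
    ultimately have "f mod g = 0"
      using min0[of "f mod g"] degree_mod_less'[of g f] monic
      by (metis coeff_0 leD zero_neq_one)
    then show ?thesis by (simp add: mod_eq_0_iff_dvd)
  qed
  have "C = PIdl\<^bsub>constacyclic_ring n \<Lambda>\<^esub> (g mod m)"
  proof (intro Set.set_eqI)
    fix c
    show "c \<in> C \<longleftrightarrow> c \<in> PIdl\<^bsub>constacyclic_ring n \<Lambda>\<^esub> (g mod m)"
    proof
      assume c: "c \<in> C"
      then have "c mod m = c" using C' by (auto simp: m_def mod_constacyclic_modulus_id)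
      moreover from this c obtain k where "c = g * k" using g_dvd[of c] by (auto simp: J_def)
      ultimately have "c = (k * g) mod m" by (simp add: mult.commute)
      then show "c \<in> PIdl\<^bsub>constacyclic_ring n \<Lambda>\<^esub> (g mod m)"
        using C' mem_PIdl_constacyclic_ring[of n c \<Lambda> g] by (auto simp: m_def)
    next
      assume "c \<in> PIdl\<^bsub>constacyclic_ring n \<Lambda>\<^esub> (g mod m)"
      then obtain r where "c = (r * g) mod m"
        using C' mem_PIdl_constacyclic_ring[of n c \<Lambda> g] by (auto simp: m_def)
      then show "c \<in> C" using lJ[OF gJ, of r] by (simp add: J_def)
    qed
  qed
  with monic g_dvd[OF mJ] have "is_generator_poly n \<Lambda> C g"
    by (simp add: is_generator_poly_def m_def)
  then show ?thesis ..
qed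

lemma is_generator_poly_generator_poly:
  assumes "constacyclic_code n \<Lambda> C"
  shows "is_generator_poly n \<Lambda> C (generator_poly n \<Lambda> C)"
proof -
  have "n > 0" using assms by (simp add: constacyclic_code_def)
  then have "\<exists>!g. is_generator_poly n \<Lambda> C g"
    using ex_is_generator_poly[OF assms] is_generator_poly_unique by blast
  then show ?thesis unfolding generator_poly_def by (rule theI')
qed


subsection \<open>Cores and Schur powers of constacyclic codes are constacyclic\<close>

lemma pattern_poly_mult:
  assumes "v dvd n"
  shows "pattern_poly n v \<alpha> * (monom \<alpha> v - 1) = monom (\<alpha> ^ (n div v)) n - 1"
proof -
  have pow: "monom \<alpha> v ^ j = monom (\<alpha> ^ j) (j * v)" for j
    by (simp add: monom_power mult.commute)
  have "pattern_poly n v \<alpha> * (monom \<alpha> v - 1) = (monom \<alpha> v - 1) * (\<Sum>j<n div v. monom \<alpha> v ^ j)"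
    by (simp add: pattern_poly_def pow mult.commute)
  also have "\<dots> = monom \<alpha> v ^ (n div v) - 1" by (rule power_diff_1_eq[symmetric])
  finally show ?thesis using assms by (simp add: pow)
qed

lemma constacyclic_modulus_factor:
  assumes C: "constacyclic_code n \<Lambda> C" and p: "is_pattern n \<Lambda> C v \<alpha>" and nt: "pattern_poly n v \<alpha> \<noteq> 1"
  shows "\<alpha> ^ (n div v) * \<Lambda> = 1"
    and "smult (\<alpha> ^ (n div v)) (constacyclic_modulus n \<Lambda>) =
      smult \<alpha> (pattern_poly n v \<alpha> * constacyclic_modulus v (inverse \<alpha>))"
proof -
  let ?p = "pattern_poly n v \<alpha>"
  let ?k = "n div v"
  have n: "n > 0" using C by (simp add: constacyclic_code_def)
  have v: "v dvd n" and a: "\<alpha> \<noteq> 0" using p by (auto simp: is_pattern_def)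
  have v0: "v > 0" using v n by (auto intro: Nat.gr0I)
  have vn: "v < n"
  proof (rule ccontr)
    assume "\<not> v < n"
    then have "v = n" using v n by (simp add: dvd_imp_le le_antisym)
    then show False using nt n by (simp add: pattern_poly_def)
  qed
  have eq: "?p * (monom \<alpha> v - 1) = monom (\<alpha> ^ ?k) n - 1" using v by (rule pattern_poly_mult)
  have deg1: "degree (monom b k - (1 :: 'a poly)) = k" if "k > 0" "b \<noteq> 0" for b k
  proof -
    have "degree (monom b k + (- 1 :: 'a poly)) = degree (monom b k)"
      using that by (intro degree_add_eq_left) (simp add: degree_monom_eq)
    then show ?thesis using that by (simp add: degree_monom_eq)
  qed
  have deg: "degree ?p + v = n"
  proof -
    have "?p \<noteq> 0" "monom \<alpha> v - (1::'a poly) \<noteq> 0"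
      using eq deg1[of n "\<alpha> ^ ?k"] n a by fastforce+
    then have "degree (?p * (monom \<alpha> v - 1)) = degree ?p + v"
      using deg1[OF v0 a] by (simp add: degree_mult_eq)
    then show ?thesis using eq deg1[of n "\<alpha> ^ ?k"] n a by simp
  qed
  have "generator_poly n \<Lambda> C dvd constacyclic_modulus n \<Lambda>"
    using is_generator_poly_generator_poly[OF C] by (simp add: is_generator_poly_def)
  then have 1: "?p dvd constacyclic_modulus n \<Lambda>"
    using p dvd_trans by (auto simp: is_pattern_def)
  have 2: "?p dvd monom (\<alpha> ^ ?k) n - 1" using eq by (metis dvd_triv_left)
  have "monom (\<alpha> ^ ?k) n - 1 - smult (\<alpha> ^ ?k) (constacyclic_modulus n \<Lambda>) = [:\<alpha> ^ ?k * \<Lambda> - 1:]"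
    by (simp add: constacyclic_modulus_def smult_diff_right smult_monom one_pCons)
  then have dvd: "?p dvd [:\<alpha> ^ ?k * \<Lambda> - 1:]"
    using 1 2 by (metis dvd_diff dvd_smult)
  show al: "\<alpha> ^ ?k * \<Lambda> = 1"
  proof (rule ccontr)
    assume "\<alpha> ^ ?k * \<Lambda> \<noteq> 1"
    then have "degree ?p \<le> degree [:\<alpha> ^ ?k * \<Lambda> - 1:]"
      using dvd by (intro dvd_imp_degree_le) auto
    then show False using deg vn by simp
  qed
  have "smult (\<alpha> ^ ?k) (constacyclic_modulus n \<Lambda>) = monom (\<alpha> ^ ?k) n - 1"
    using al by (simp add: constacyclic_modulus_def smult_diff_right smult_monom one_pCons)
  moreover have "smult \<alpha> (constacyclic_modulus v (inverse \<alpha>)) = monom \<alpha> v - 1"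
    using a by (simp add: constacyclic_modulus_def smult_diff_right smult_monom one_pCons)
  ultimately show "smult (\<alpha> ^ ?k) (constacyclic_modulus n \<Lambda>) =
      smult \<alpha> (?p * constacyclic_modulus v (inverse \<alpha>))"
    using eq by (metis mult_smult_right)
qed

lemma constacyclic_code_core:
  assumes C: "constacyclic_code n \<Lambda> C" and p: "is_pattern n \<Lambda> C v \<alpha>" and nt: "pattern_poly n v \<alpha> \<noteq> 1"
  shows "constacyclic_code v (inverse \<alpha>) (core (pattern_poly n v \<alpha>) C)"
proof -
  let ?p = "pattern_poly n v \<alpha>"
  let ?M = "constacyclic_modulus n \<Lambda>" and ?m = "constacyclic_modulus v (inverse \<alpha>)"
  note C' = C[unfolded constacyclic_code_iff]
  have n: "n > 0" using C by (simp add: constacyclic_code_def)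
  have v: "v dvd n" and a: "\<alpha> \<noteq> 0" using p by (auto simp: is_pattern_def)
  have v0: "v > 0" using v n by (auto intro: Nat.gr0I)
  have fac: "smult (\<alpha> ^ (n div v)) ?M = smult \<alpha> (?p * ?m)"
    by (rule constacyclic_modulus_factor(2)[OF assms])
  have ak: "\<alpha> ^ (n div v) \<noteq> 0" using a by simp
  have p0: "?p \<noteq> 0"
  proof
    assume "?p = 0"
    then have "smult (\<alpha> ^ (n div v)) ?M = 0" using fac by simp
    then show False using ak constacyclic_modulus_neq_0[OF n, of \<Lambda>] by simp
  qed
  have deg: "degree ?p + v = n"
  proof -
    have "degree (?p * ?m) = degree ?p + v"
      using p0 constacyclic_modulus_neq_0[OF v0, of "inverse \<alpha>"]
        degree_constacyclic_modulus[OF v0, of "inverse \<alpha>"]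
      by (simp add: degree_mult_eq)
    moreover have "degree (smult \<alpha> (?p * ?m)) = degree (smult (\<alpha> ^ (n div v)) ?M)"
      by (simp only: fac)
    ultimately show ?thesis using a ak degree_constacyclic_modulus[OF n, of \<Lambda>] by simp
  qed
  have pM: "?M dvd ?p * ?m"
  proof -
    have "?M dvd smult (\<alpha> ^ (n div v)) ?M" by (simp add: dvd_smult)
    then show ?thesis unfolding fac using a by (rule dvd_smult_cancel)
  qed
  have dvd: "?p dvd c" if "c \<in> C" for c
    using is_generator_poly_dvd[OF n is_generator_poly_generator_poly[OF C] that] p dvd_trans
    by (auto simp: is_pattern_def)
  have mem: "d \<in> core ?p C \<longleftrightarrow> ?p * d \<in> C" for d
  proof
    assume "d \<in> core ?p C"
    then show "?p * d \<in> C" using dvd by (auto simp: core_def)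
  next
    assume "?p * d \<in> C"
    then show "d \<in> core ?p C" unfolding core_def using p0 by (intro image_eqI[of _ _ "?p * d"]) auto
  qed
  have degc: "degree (?p * d) < n \<longleftrightarrow> degree d < v" for d
    using deg p0 v0 n by (cases "d = 0") (auto simp: degree_mult_eq)
  show ?thesis
    unfolding constacyclic_code_iff
  proof (intro conjI ballI allI)
    show "core ?p C \<subseteq> {c. degree c < v}" using C' mem degc by auto
    fix c r assume c: "c \<in> core ?p C"
    have "?p * ((r * c) mod ?m) = (?p * (r * c)) mod (?p * ?m)" by (rule mult_mod_right)
    then have "(?p * ((r * c) mod ?m)) mod ?M = (?p * (r * c)) mod ?M"
      by (simp only: mod_mod_cancel[OF pM])
    moreover have "degree (?p * ((r * c) mod ?m)) < n"
      using degc degree_mod_constacyclic_modulus[OF v0] by blast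
    ultimately have "?p * ((r * c) mod ?m) = (r * (?p * c)) mod ?M"
      by (simp add: mod_constacyclic_modulus_id mult.left_commute)
    then show "(r * c) mod ?m \<in> core ?p C" using C' c mem by simp
  qed (use v0 a C' mem in \<open>auto simp: distrib_left\<close>)
qed

lemma coeff_schur [simp]: "coeff (f \<odot> g) k = coeff f k * coeff g k"
  by transfer simp

interpretation poly_module: module "smult :: 'a::field \<Rightarrow> 'a poly \<Rightarrow> 'a poly"
  by unfold_locales (simp_all add: smult_add_right smult_add_left)

lemma x_mult_mod_constacyclic_modulus:
  assumes "degree f < n"
  shows "pCons 0 f mod constacyclic_modulus n \<Lambda> =
    pCons 0 f - smult (coeff f (n - 1)) (constacyclic_modulus n \<Lambda>)"
    (is "_ = ?h")
proof -
  have n: "n > 0" using assms by simp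
  have "coeff ?h k = 0" if "k > n - 1" for k
  proof (cases "k = n")
    case True
    then show ?thesis using n
      by (simp add: constacyclic_modulus_def coeff_pCons split: nat.splits)
  next
    case False
    then have "k > n" using that by simp
    then show ?thesis using assms
      by (auto simp: constacyclic_modulus_def coeff_pCons coeff_eq_0 split: nat.splits)
  qed
  then have "degree ?h \<le> n - 1" by (intro degree_le) auto
  then have "degree ?h < n" using n by simp
  then have "?h = ?h mod constacyclic_modulus n \<Lambda>" by (simp add: mod_constacyclic_modulus_id)
  also have "\<dots> = pCons 0 f mod constacyclic_modulus n \<Lambda>"
    by (simp add: poly_mod_diff_left mod_smult_left)
  finally show ?thesis ..
qed

lemma coeff_x_mult_mod_constacyclic_modulus:
  assumes "degree f < n"
  shows "coeff (pCons 0 f mod constacyclic_modulus n \<Lambda>) k =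
    (if k = 0 then \<Lambda> * coeff f (n - 1) else if k < n then coeff f (k - 1) else 0)"
  unfolding x_mult_mod_constacyclic_modulus[OF assms]
  unfolding constacyclic_modulus_def
  using assms by (cases k) (auto simp: coeff_pCons coeff_eq_0)

lemma constacyclic_code_schur_code:
  assumes C: "constacyclic_code n \<Lambda> C" and D: "constacyclic_code n \<mu> D"
  shows "constacyclic_code n (\<Lambda> * \<mu>) (schur_code C D)"
proof -
  let ?S = "{c \<odot> d | c d. c \<in> C \<and> d \<in> D}"
  let ?m = "constacyclic_modulus n (\<Lambda> * \<mu>)"
  note C' = C[unfolded constacyclic_code_iff] and D' = D[unfolded constacyclic_code_iff]
  have n: "n > 0" using C by (simp add: constacyclic_code_def)
  have degS: "degree (c \<odot> d) < n" if "c \<in> C" for c d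
  proof -
    have "degree (c \<odot> d) \<le> degree c" by (intro degree_le) (simp add: coeff_eq_0)
    then show ?thesis using that C' by fastforce
  qed
  have deg: "degree f < n" if "f \<in> poly_module.span ?S" for f
    using that
  proof (induction rule: poly_module.span_induct_alt)
    case base
    then show ?case using n by simp
  next
    case (step a x y)
    then show ?case using degS
      by (auto intro!: degree_add_less order.strict_trans1[OF degree_smult_le])
  qed
  have shift: "pCons 0 f mod ?m \<in> poly_module.span ?S" if "f \<in> poly_module.span ?S" for f
    using that
  proof (induction rule: poly_module.span_induct_alt)
    case base
    then show ?case by (simp add: poly_module.span_zero)
  next
    case (step a x y)
    then obtain c d where x: "x = c \<odot> d" and c: "c \<in> C" and d: "d \<in> D" by blast
    define c' where "c' = pCons 0 c mod constacyclic_modulus n \<Lambda>"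
    define d' where "d' = pCons 0 d mod constacyclic_modulus n \<mu>"
    have "([:0, 1:] * c) mod constacyclic_modulus n \<Lambda> \<in> C" using c C' by blast
    then have c': "c' \<in> C" by (simp add: c'_def)
    have "([:0, 1:] * d) mod constacyclic_modulus n \<mu> \<in> D" using d D' by blast
    then have d': "d' \<in> D" by (simp add: d'_def)
    have "degree c < n" "degree d < n" using c d C' D' by auto
    then have "pCons 0 x mod ?m = c' \<odot> d'"
      using degS[OF c, of d]
      by (intro poly_eqI)
        (simp add: x c'_def d'_def coeff_x_mult_mod_constacyclic_modulus)
    then have "pCons 0 x mod ?m \<in> poly_module.span ?S"
      using c' d' by (auto intro!: poly_module.span_base)
    moreover have "pCons 0 (smult a x + y) mod ?m =
        smult a (pCons 0 x mod ?m) + pCons 0 y mod ?m"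
    proof -
      have "pCons 0 (smult a x + y) = smult a (pCons 0 x) + pCons 0 y" by simp
      then show ?thesis by (simp only: poly_mod_add_left mod_smult_left)
    qed
    ultimately show ?case
      using step.IH by (auto intro: poly_module.span_add poly_module.span_scale)
  qed
  have mult: "(r * f) mod ?m \<in> poly_module.span ?S" if f: "f \<in> poly_module.span ?S" for r f
  proof (induction r)
    case 0
    then show ?case by (simp add: poly_module.span_zero)
  next
    case (pCons a r)
    have "(pCons a r * f) mod ?m = smult a (f mod ?m) + pCons 0 (r * f) mod ?m"
      by (simp add: mult_pCons_left poly_mod_add_left mod_smult_left)
    also have "f mod ?m = f" using deg[OF f] by (simp add: mod_constacyclic_modulus_id)
    also have "pCons 0 (r * f) mod ?m = pCons 0 ((r * f) mod ?m) mod ?m"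
      using mod_mult_right_eq[of "[:0, 1:]" "r * f" ?m] by simp
    finally show ?case
      using f shift[OF pCons.IH] by (auto intro: poly_module.span_add poly_module.span_scale)
  qed
  show ?thesis
    unfolding constacyclic_code_iff schur_code_def
    using n C' D' deg mult by (auto intro: poly_module.span_zero poly_module.span_add)
qed

lemma constacyclic_code_schur_code_power:
  assumes C: "constacyclic_code n \<Lambda> C" and i: "i \<ge> 1"
  shows "constacyclic_code n (\<Lambda> ^ i) (schur_code_power C i)"
  using i
proof (induction i rule: dec_induct)
  case base
  then show ?case using C by (simp add: schur_code_power_def)
next
  case (step i)
  then have "schur_code_power C (Suc i) = schur_code (schur_code_power C i) C"
    by (cases i) (simp_all add: schur_code_power_def)
  then show ?case using constacyclic_code_schur_code[OF step.IH C] by (simp add: mult.commute)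
qed

end

theory Submission
  imports Defs
begin

text \<open>
  Multiplying a polynomial \<open>d\<close> of degree less than \<open>v\<close> by the pattern polynomial of \<open>\<alpha>\<close> places
  the blocks \<open>d, \<alpha> d, \<alpha>\<^sup>2 d, \<dots>\<close> of length \<open>v\<close> next to each other.  Hence the Schur product of
  such multiples of two pattern polynomials is the Schur product of the blocks times the
  pattern polynomial of the product of the two parameters, and \<open>C\<^sup>\<circ>\<^sup>i\<close> is the \<open>i\<close>-th Schur power
  of the core times the pattern polynomial of \<open>\<alpha>\<^sup>i\<close>.  As \<open>x^n - \<Lambda>\<^sup>i\<close> is, up to a constant, this
  pattern polynomial times the modulus \<open>x^v - \<alpha>\<^sup>-\<^sup>i\<close> of the core power, generator polynomials
  are carried along.
\<close>

text \<open>As \<open>degree d < v\<close>, the shifts of \<open>d\<close> by multiples of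
  \<open>v\<close> do not overlap: only the summand \<open>j = k div v\<close> can reach position
  \<open>k\<close>, and it does so at offset \<open>k mod v\<close>.\<close>

lemma coeff_pattern_poly_mult:
  assumes v: "v dvd n" and d: "degree d < v"
  shows "coeff (pattern_poly n v \<alpha> * d) k =
    (if k < n then \<alpha> ^ (k div v) * coeff d (k mod v) else 0)"
proof -
  have v0: "v > 0" using d by simp
  have summand: "coeff (monom (\<alpha> ^ j) (j * v) * d) k =
      (if j = k div v then \<alpha> ^ (k div v) * coeff d (k mod v) else 0)" for j
  proof (cases j "k div v" rule: linorder_cases)
    case less
    then have "Suc j * v \<le> k"
      by (metis Suc_leI div_times_less_eq_dividend mult_le_mono1 order.trans)
    then have "degree d < k - j * v" using d by simp
    then show ?thesis using less by (simp add: coeff_monom_mult coeff_eq_0)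
  next
    case equal
    have "\<not> k < k div v * v" by (simp only: not_less div_times_less_eq_dividend)
    then show ?thesis using equal by (simp add: coeff_monom_mult minus_div_mult_eq_mod)
  next
    case greater
    then have "k < j * v" using v0 by (simp add: div_less_iff_less_mult)
    then show ?thesis using greater by (simp add: coeff_monom_mult)
  qed
  \<comment> \<open>Divisibility of \<open>n\<close> by \<open>v\<close> makes the last block end
    exactly at position \<open>n\<close>.\<close>
  have "k div v < n div v \<longleftrightarrow> k < n"
    using v v0 by (simp add: div_less_iff_less_mult)
  then show ?thesis
    by (simp add: pattern_poly_def sum_distrib_right coeff_sum summand)
qed

lemma schur_pattern_poly_mult:
  assumes v: "v dvd n" and d: "degree d < v" and e: "degree e < v"
  shows "(pattern_poly n v \<alpha> * d) \<odot> (pattern_poly n v \<beta> * e) =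
    pattern_poly n v (\<alpha> * \<beta>) * (d \<odot> e)"
proof -
  have "degree (d \<odot> e) \<le> degree d" by (intro degree_le) (simp add: coeff_eq_0)
  then have "degree (d \<odot> e) < v" using d by simp
  then show ?thesis
    using assms by (intro poly_eqI) (simp add: coeff_pattern_poly_mult power_mult_distrib)
qed

text \<open>Multiplication by a fixed polynomial is linear and hence commutes with taking spans, so
  it suffices to compare the spanning sets product by product.\<close>

lemma schur_code_pattern_poly_mult:
  assumes v: "v dvd n" and D: "D \<subseteq> {d. degree d < v}" and E: "E \<subseteq> {e. degree e < v}"
  shows "schur_code ((*) (pattern_poly n v \<alpha>) ` D) ((*) (pattern_poly n v \<beta>) ` E) =
    (*) (pattern_poly n v (\<alpha> * \<beta>)) ` schur_code D E"
proof -
  let ?p = "pattern_poly n v (\<alpha> * \<beta>)"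
  interpret module_hom smult smult "(*) ?p"
    by unfold_locales (simp_all add: distrib_left)
  have "{c \<odot> d | c d. c \<in> (*) (pattern_poly n v \<alpha>) ` D \<and> d \<in> (*) (pattern_poly n v \<beta>) ` E} =
      (\<lambda>(d, e). (pattern_poly n v \<alpha> * d) \<odot> (pattern_poly n v \<beta> * e)) ` (D \<times> E)"
    by fastforce
  also have "\<dots> = (\<lambda>(d, e). ?p * (d \<odot> e)) ` (D \<times> E)"
    using D E by (intro image_cong) (auto intro!: schur_pattern_poly_mult[OF v])
  also have "\<dots> = (*) ?p ` {d \<odot> e | d e. d \<in> D \<and> e \<in> E}"
    by fastforce
  finally show ?thesis
    by (simp add: schur_code_def span_image)
qed

lemma schur_code_power_Suc:
  "i \<ge> 1 \<Longrightarrow> schur_code_power C (Suc i) = schur_code (schur_code_power C i) C"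
  by (cases i) (simp_all add: schur_code_power_def)

lemma schur_power_Suc: "i \<ge> 1 \<Longrightarrow> schur_power f (Suc i) = schur_power f i \<odot> f"
  by (cases i) (simp_all add: schur_power_def)

text \<open>Constacyclicity of \<open>D\<close> passes to its Schur powers and so keeps their
  degrees below \<open>v\<close>, as each induction step requires.\<close>

lemma schur_code_power_pattern_poly_mult:
  assumes v: "v dvd n" and D: "constacyclic_code v \<mu> D" and i: "i \<ge> 1"
  shows "schur_code_power ((*) (pattern_poly n v \<alpha>) ` D) i =
    (*) (pattern_poly n v (\<alpha> ^ i)) ` schur_code_power D i"
  using i
proof (induction i rule: dec_induct)
  case base
  show ?case by (simp add: schur_code_power_def)
next
  case (step i)
  have "D \<subseteq> {d. degree d < v}" "schur_code_power D i \<subseteq> {d. degree d < v}"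
    using D constacyclic_code_schur_code_power[OF D] step.hyps(1)
    by (simp_all add: constacyclic_code_iff)
  then show ?case
    using step schur_code_pattern_poly_mult[OF v, of "schur_code_power D i" D "\<alpha> ^ i" \<alpha>]
    by (simp add: schur_code_power_Suc power_Suc2 del: power_Suc)
qed

lemma schur_power_pattern_poly:
  assumes v: "v dvd n" and v0: "v > 0" and i: "i \<ge> 1"
  shows "schur_power (pattern_poly n v \<alpha>) i = pattern_poly n v (\<alpha> ^ i)"
  using i
proof (induction i rule: dec_induct)
  case base
  show ?case by (simp add: schur_power_def)
next
  case (step i)
  \<comment> \<open>A pattern polynomial is its own multiple by the block \<open>1\<close>, which is
    idempotent for the Schur product.\<close>
  have "(1 :: 'a poly) \<odot> 1 = 1" by (intro poly_eqI) (auto simp: coeff_1)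
  then show ?case
    using step schur_pattern_poly_mult[OF v, of 1 1 "\<alpha> ^ i" \<alpha>] v0
    by (simp add: schur_power_Suc mult.commute)
qed

text \<open>Both sides are the geometric sum identity \<open>pattern_poly_mult\<close> up to
  constants. Only the relation between \<beta> and \<Lambda> enters, so \<beta> can be
  \<open>\<alpha> ^ i\<close> without a proof that this is a pattern of the Schur power.\<close>

lemma pattern_poly_mult_constacyclic_modulus:
  assumes v: "v dvd n" and b: "\<beta> \<noteq> 0" and L: "\<beta> ^ (n div v) * \<Lambda> = 1"
  shows "pattern_poly n v \<beta> * constacyclic_modulus v (inverse \<beta>) =
    smult (\<beta> ^ (n div v) / \<beta>) (constacyclic_modulus n \<Lambda>)"
proof -
  have "smult \<beta> (constacyclic_modulus v (inverse \<beta>)) = monom \<beta> v - 1"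
    using b by (simp add: constacyclic_modulus_def smult_diff_right smult_monom one_pCons)
  moreover have "smult (\<beta> ^ (n div v)) (constacyclic_modulus n \<Lambda>) = monom (\<beta> ^ (n div v)) n - 1"
    using L by (simp add: constacyclic_modulus_def smult_diff_right smult_monom one_pCons)
  ultimately have "smult \<beta> (pattern_poly n v \<beta> * constacyclic_modulus v (inverse \<beta>)) =
      smult (\<beta> ^ (n div v)) (constacyclic_modulus n \<Lambda>)"
    using pattern_poly_mult[OF v, of \<beta>] by (metis mult_smult_right)
  then have "smult (inverse \<beta>) (smult \<beta> (pattern_poly n v \<beta> * constacyclic_modulus v (inverse \<beta>))) =
      smult (inverse \<beta>) (smult (\<beta> ^ (n div v)) (constacyclic_modulus n \<Lambda>))"
    by (rule arg_cong)
  then show ?thesis using b by (simp add: divide_inverse mult.commute)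
qed

text \<open>Multiplication by the pattern polynomial turns reduction modulo the short modulus into
  reduction modulo the long one, so reduced multiples of \<open>g\<close> become reduced multiples
  of the product.\<close>

lemma is_generator_poly_pattern_poly_mult:
  assumes n: "n > 0" and v: "v dvd n" and b: "\<beta> \<noteq> 0" and L: "\<beta> ^ (n div v) * \<Lambda> = 1"
    and g: "is_generator_poly v (inverse \<beta>) D g"
  shows "is_generator_poly n \<Lambda> ((*) (pattern_poly n v \<beta>) ` D) (monic_of (g * pattern_poly n v \<beta>))"
proof -
  let ?p = "pattern_poly n v \<beta>"
  let ?M = "constacyclic_modulus n \<Lambda>" and ?m = "constacyclic_modulus v (inverse \<beta>)"
  define u where "u = \<beta> ^ (n div v) / \<beta>"
  define w where "w = inverse (lead_coeff (g * ?p))"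
  have v0: "v > 0" using v n by (auto intro: Nat.gr0I)
  have u0: "u \<noteq> 0" using b by (simp add: u_def)
  have fac: "?p * ?m = smult u ?M"
    unfolding u_def by (rule pattern_poly_mult_constacyclic_modulus[OF v b L])
  then have p0: "?p \<noteq> 0" using u0 constacyclic_modulus_neq_0[OF n, of \<Lambda>] by auto
  have g': "lead_coeff g = 1" "g dvd ?m" using g by (simp_all add: is_generator_poly_def)
  then have gp0: "g * ?p \<noteq> 0" using p0 by auto
  then have w0: "w \<noteq> 0" by (simp add: w_def)
  have monic: "monic_of (g * ?p) = smult w (g * ?p)" by (simp add: monic_of_def w_def)
  have "lead_coeff (monic_of (g * ?p)) = 1" using gp0 by (simp add: monic_of_def)
  moreover have "monic_of (g * ?p) dvd ?M"
  proof -
    have "g * ?p dvd ?p * ?m" using g'(2) by (simp add: mult.commute mult_dvd_mono)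
    then have "g * ?p dvd ?M" using u0 by (simp add: fac dvd_smult_iff)
    then show ?thesis using w0 by (simp add: monic smult_dvd_iff)
  qed
  moreover have "(*) ?p ` D = PIdl\<^bsub>constacyclic_ring n \<Lambda>\<^esub> (monic_of (g * ?p) mod ?M)"
  proof -
    \<comment> \<open>The modulus \<open>?p * ?m\<close> differs from \<open>?M\<close> only by the
      unit \<open>u\<close>; the factor \<open>inverse w\<close> undoes the normalisation.\<close>
    have red: "?p * ((r * g) mod ?m) = (smult (inverse w) r * monic_of (g * ?p)) mod ?M" for r
    proof -
      have "?p * ((r * g) mod ?m) = (?p * (r * g)) mod (?p * ?m)" by (rule mult_mod_right)
      also have "\<dots> = (?p * (r * g)) mod ?M" using u0 by (simp add: fac mod_smult_right)
      also have "?p * (r * g) = smult (inverse w) r * monic_of (g * ?p)"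
        using w0 by (simp add: monic mult_ac)
      finally show ?thesis .
    qed
    have red': "(r * monic_of (g * ?p)) mod ?M = ?p * ((smult w r * g) mod ?m)" for r
      using red[of "smult w r"] w0 by simp
    have D: "D = range (\<lambda>r. (r * g) mod ?m)"
      using g mem_PIdl_constacyclic_ring[OF v0, of _ "inverse \<beta>" g]
      by (auto simp: is_generator_poly_def)
    show ?thesis
    proof (intro Set.set_eqI iffI)
      fix c assume "c \<in> (*) ?p ` D"
      then show "c \<in> PIdl\<^bsub>constacyclic_ring n \<Lambda>\<^esub> (monic_of (g * ?p) mod ?M)"
        unfolding mem_PIdl_constacyclic_ring[OF n] D using red by blast
    next
      fix c assume "c \<in> PIdl\<^bsub>constacyclic_ring n \<Lambda>\<^esub> (monic_of (g * ?p) mod ?M)"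
      then show "c \<in> (*) ?p ` D"
        unfolding mem_PIdl_constacyclic_ring[OF n] D using red' by blast
    qed
  qed
  ultimately show ?thesis by (simp add: is_generator_poly_def)
qed

text \<open>The pattern polynomial divides the generator polynomial and thus every codeword, so the
  division in \<open>core\<close> is exact.\<close>

lemma pattern_poly_mult_core:
  assumes C: "constacyclic_code n \<Lambda> C" and p: "is_pattern n \<Lambda> C v \<alpha>"
  shows "(*) (pattern_poly n v \<alpha>) ` core (pattern_poly n v \<alpha>) C = C"
proof -
  have n: "n > 0" using C by (simp add: constacyclic_code_def)
  have "pattern_poly n v \<alpha> dvd c" if "c \<in> C" for c
    using is_generator_poly_dvd[OF n is_generator_poly_generator_poly[OF C] that] p dvd_trans
    by (auto simp: is_pattern_def)
  then have "(\<lambda>c. pattern_poly n v \<alpha> * (c div pattern_poly n v \<alpha>)) ` C = (\<lambda>c. c) ` C"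
    by (intro image_cong) auto
  then show ?thesis by (simp add: core_def image_image)
qed

theorem theorem11:
  fixes n v i :: nat and \<Lambda> \<alpha> :: "'a::{field, finite}" and C :: "'a poly set"
  assumes "n > 0" and "coprime n (card (UNIV :: 'a set))" and "\<Lambda> \<noteq> 0"
    and "constacyclic_code n \<Lambda> C"
    and "is_pattern n \<Lambda> C v \<alpha>" and "pattern_poly n v \<alpha> \<noteq> 1"
    and "i \<ge> 1"
  shows "generator_poly n (\<Lambda> ^ i) (schur_code_power C i) =
           monic_of (generator_poly v (inverse \<alpha> ^ i)
                       (schur_code_power (core (pattern_poly n v \<alpha>) C) i)
                     * schur_power (pattern_poly n v \<alpha>) i) \<and>
         schur_power (pattern_poly n v \<alpha>) i = (\<Sum>j<n div v. monom (\<alpha> ^ (i * j)) (j * v))"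
proof
  let ?p = "pattern_poly n v \<alpha>"
  let ?D = "core ?p C"
  have v: "v dvd n" and a: "\<alpha> \<noteq> 0" using assms(5) by (auto simp: is_pattern_def)
  have v0: "v > 0" using v assms(1) by (auto intro: Nat.gr0I)
  have D: "constacyclic_code v (inverse \<alpha>) ?D"
    using assms(4-6) by (rule constacyclic_code_core)
  have power: "schur_power ?p i = pattern_poly n v (\<alpha> ^ i)"
    using v v0 assms(7) by (rule schur_power_pattern_poly)
  then show "schur_power ?p i = (\<Sum>j<n div v. monom (\<alpha> ^ (i * j)) (j * v))"
    by (simp add: pattern_poly_def power_mult)
  have Ci: "schur_code_power C i = (*) (pattern_poly n v (\<alpha> ^ i)) ` schur_code_power ?D i"
    using schur_code_power_pattern_poly_mult[OF v D assms(7), of \<alpha>]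
    by (simp add: pattern_poly_mult_core[OF assms(4,5)])
  \<comment> \<open>The relation between \<alpha> and \<Lambda> is raised to the power
    \<open>i\<close>.\<close>
  have "(\<alpha> ^ i) ^ (n div v) * \<Lambda> ^ i = (\<alpha> ^ (n div v) * \<Lambda>) ^ i"
    by (simp add: power_mult_distrib mult.commute flip: power_mult)
  then have L: "(\<alpha> ^ i) ^ (n div v) * \<Lambda> ^ i = 1"
    using constacyclic_modulus_factor(1)[OF assms(4-6)] by simp
  have "is_generator_poly v (inverse (\<alpha> ^ i)) (schur_code_power ?D i)
      (generator_poly v (inverse \<alpha> ^ i) (schur_code_power ?D i))"
    using is_generator_poly_generator_poly[OF constacyclic_code_schur_code_power[OF D assms(7)]]
    by (simp add: power_inverse)
  then have "is_generator_poly n (\<Lambda> ^ i) (schur_code_power C i)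
      (monic_of (generator_poly v (inverse \<alpha> ^ i) (schur_code_power ?D i) * schur_power ?p i))"
    unfolding Ci power
    using assms(1) v a L by (intro is_generator_poly_pattern_poly_mult) simp_all
  \<comment> \<open>Both polynomials generate the same code, so uniqueness identifies them.\<close>
  moreover have "is_generator_poly n (\<Lambda> ^ i) (schur_code_power C i)
      (generator_poly n (\<Lambda> ^ i) (schur_code_power C i))"
    using assms(4,7) by (intro is_generator_poly_generator_poly constacyclic_code_schur_code_power)
  ultimately show "generator_poly n (\<Lambda> ^ i) (schur_code_power C i) =
      monic_of (generator_poly v (inverse \<alpha> ^ i) (schur_code_power ?D i) * schur_power ?p i)"
    using assms(1) is_generator_poly_unique by blast
qed

end
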